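(* Let $\ell\ge 2$. Suppose that $\lambda$ is an $\ell$-partition and $0\le i<\ell$. Write $\varphi=\varphi_i(\lambda)$ and $\varepsilon=\varepsilon_i(\lambda)$. Then 1. $\widetilde f_i^{\,k}\lambda$ is not an $\ell$-partition for $0<k<\varphi-1$; 2. $\widetilde e_i^{\,k}\lambda$ is not an $\ell$-partition for $1<k<\varepsilon$.
   Context: A partition is $\ell$-regular if it does not have $\ell$ or more equal nonzero parts. A removable $\ell$-rim hook (for short, $\ell$-rim hook) of $\lambda$ is a connected sequence of $\ell$ boxes of the Young diagram of $\lambda$, containing no $2\times2$ square, whose removal from $\lambda$ leaves the Young diagram of a partition. It is horizontal if all its boxes lie in one row, and non-horizontal otherwise. An $\ell$-partition is an $\ell$-regular partition which has no non-horizontal $\ell$-rim hooks and such that, after removing any number of horizontal $\ell$-rim hooks in any order, the remaining diagram has no non-horizontal $\ell$-rim hooks. Crystal $B(\Lambda_0)$ of $\widehat{\mathfrak{sl}_\ell}$ (nodes: the $\ell$-regular partitions). The position in row $a$, column $b$ has residue $b-a \bmod \ell$. A box $x$ of $\lambda$ is a removable $i$-box if it has residue $i$ and $\lambda\setminus x$ is a partition; a position $y\notin\lambda$ is an addable $i$-box if it has residue $i$ and $\lambda\cup y$ is a partition. Put $-$ in each removable $i$-box and $+$ in each addable $i$-box. The $i$-signature of $\lambda$ is the word of $+$'s and $-$'s read from bottom left to top right; the reduced $i$-signature is obtained by repeatedly deleting adjacent pairs $-+$, giving a word $+\cdots+-\cdots-$. Boxes of the remaining $-$'s are the normal $i$-boxes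 and boxes of the remaining $+$'s are the conormal $i$-boxes; $\varepsilon_i(\lambda)$ and $\varphi_i(\lambda)$ are their respective numbers. The good $i$-box is the one of the leftmost remaining $-$; the cogood $i$-box is the one of the rightmost remaining $+$. $\widetilde e_i\lambda$ is $\lambda$ with its good $i$-box removed (or $0$ if there is none), and $\widetilde f_i\lambda$ is $\lambda$ with its cogood $i$-box added (or $0$ if there is none). *)

theory Defs
  imports Main
begin

(* A partition is identified with its Young diagram (English convention: row 0 at the top).
   Rows and columns are numbered from 0, which leaves all differences (column - row), hence
   all residues, unchanged. *)

type_synonym box = "nat \<times> nat"
type_synonym diagram = "box set"

definition is_partition :: "diagram \<Rightarrow> bool" where
  "is_partition D \<longleftrightarrow> finite D \<and>
     (\<forall>a b a' b'. (a, b) \<in> D \<longrightarrow> a' \<le> a \<longrightarrow> b' \<le> b \<longrightarrow> (a', b') \<in> D)"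

definition part :: "diagram \<Rightarrow> nat \<Rightarrow> nat" where
  "part D a = card {b. (a, b) \<in> D}"

definition l_regular :: "nat \<Rightarrow> diagram \<Rightarrow> bool" where
  "l_regular l D \<longleftrightarrow> (\<forall>m > 0. card {a. part D a = m} < l)"

definition adjacent :: "box \<Rightarrow> box \<Rightarrow> bool" where
  "adjacent x y \<longleftrightarrow>
     (fst x = fst y \<and> (snd x = Suc (snd y) \<or> snd y = Suc (snd x))) \<or>
     (snd x = snd y \<and> (fst x = Suc (fst y) \<or> fst y = Suc (fst x)))"

definition connected_boxes :: "box set \<Rightarrow> bool" where
  "connected_boxes R \<longleftrightarrow>
     (\<forall>x\<in>R. \<forall>y\<in>R. (\<lambda>u v. u \<in> R \<and> v \<in> R \<and> adjacent u v)\<^sup>*\<^sup>* x y)"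

definition has_square :: "box set \<Rightarrow> bool" where
  "has_square R \<longleftrightarrow> (\<exists>a b. {(a, b), (Suc a, b), (a, Suc b), (Suc a, Suc b)} \<subseteq> R)"

definition rim_hook :: "nat \<Rightarrow> diagram \<Rightarrow> box set \<Rightarrow> bool" where
  "rim_hook l D R \<longleftrightarrow> R \<subseteq> D \<and> card R = l \<and> connected_boxes R \<and> \<not> has_square R \<and>
     is_partition (D - R)"

definition horizontal :: "box set \<Rightarrow> bool" where
  "horizontal R \<longleftrightarrow> (\<exists>a. \<forall>x\<in>R. fst x = a)"

definition remove_horizontal :: "nat \<Rightarrow> diagram \<Rightarrow> diagram \<Rightarrow> bool" where
  "remove_horizontal l D E \<longleftrightarrow> (\<exists>R. rim_hook l D R \<and> horizontal R \<and> E = D - R)"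

definition l_partition :: "nat \<Rightarrow> diagram \<Rightarrow> bool" where
  "l_partition l D \<longleftrightarrow> is_partition D \<and> l_regular l D \<and>
     (\<forall>R. rim_hook l D R \<longrightarrow> horizontal R) \<and>
     (\<forall>E. (remove_horizontal l)\<^sup>*\<^sup>* D E \<longrightarrow> (\<forall>R. rim_hook l E R \<longrightarrow> horizontal R))"

definition content :: "box \<Rightarrow> int" where
  "content x = int (snd x) - int (fst x)"

definition residue :: "nat \<Rightarrow> box \<Rightarrow> int" where
  "residue l x = content x mod int l"

definition removable :: "nat \<Rightarrow> int \<Rightarrow> diagram \<Rightarrow> box \<Rightarrow> bool" where
  "removable l i D x \<longleftrightarrow> x \<in> D \<and> residue l x = i \<and> is_partition (D - {x})"

definition addable :: "nat \<Rightarrow> int \<Rightarrow> diagram \<Rightarrow> box \<Rightarrow> bool" where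
  "addable l i D x \<longleftrightarrow> x \<notin> D \<and> residue l x = i \<and> is_partition (insert x D)"

datatype sign = Plus | Minus

(* The letters of a signature carry their boxes. The addable and removable boxes of a
   partition have pairwise distinct contents, and reading them from bottom left to top right
   is reading them by increasing content. *)

definition signature :: "nat \<Rightarrow> int \<Rightarrow> diagram \<Rightarrow> (sign \<times> box) list" where
  "signature l i D =
     map (\<lambda>x. (if x \<in> D then Minus else Plus, x))
       (sorted_key_list_of_set content {x. removable l i D x \<or> addable l i D x})"

inductive delete_pair :: "(sign \<times> 'a) list \<Rightarrow> (sign \<times> 'a) list \<Rightarrow> bool" where
  "delete_pair (u @ (Minus, x) # (Plus, y) # v) (u @ v)"

definition reduced :: "(sign \<times> 'a) list \<Rightarrow> (sign \<times> 'a) list" where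
  "reduced w = (THE w'. delete_pair\<^sup>*\<^sup>* w w' \<and> \<not> (\<exists>w''. delete_pair w' w''))"

definition normal_boxes :: "nat \<Rightarrow> int \<Rightarrow> diagram \<Rightarrow> box list" where
  "normal_boxes l i D = map snd (filter (\<lambda>p. fst p = Minus) (reduced (signature l i D)))"

definition conormal_boxes :: "nat \<Rightarrow> int \<Rightarrow> diagram \<Rightarrow> box list" where
  "conormal_boxes l i D = map snd (filter (\<lambda>p. fst p = Plus) (reduced (signature l i D)))"

definition eps :: "nat \<Rightarrow> int \<Rightarrow> diagram \<Rightarrow> nat" where
  "eps l i D = length (normal_boxes l i D)"

definition phi :: "nat \<Rightarrow> int \<Rightarrow> diagram \<Rightarrow> nat" where
  "phi l i D = length (conormal_boxes l i D)"

(* None is the element 0 of the crystal. *)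

definition e_op :: "nat \<Rightarrow> int \<Rightarrow> diagram \<Rightarrow> diagram option" where
  "e_op l i D =
     (if normal_boxes l i D = [] then None else Some (D - {hd (normal_boxes l i D)}))"

definition f_op :: "nat \<Rightarrow> int \<Rightarrow> diagram \<Rightarrow> diagram option" where
  "f_op l i D =
     (if conormal_boxes l i D = [] then None else Some (insert (last (conormal_boxes l i D)) D))"

definition iterate :: "('a \<Rightarrow> 'a option) \<Rightarrow> nat \<Rightarrow> 'a \<Rightarrow> 'a option" where
  "iterate g k x = ((\<lambda>y. Option.bind y g) ^^ k) (Some x)"

(* The order of the deletions is immaterial, so the description in reduced is a definite one. *)

fun reduce :: "(sign \<times> 'a) list \<Rightarrow> (sign \<times> 'a) list" where
  "reduce [] = []"
| "reduce ((Plus, x) # w) = (Plus, x) # reduce w"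
| "reduce ((Minus, x) # w) =
     (case reduce w of (Plus, y) # w' \<Rightarrow> w' | w' \<Rightarrow> (Minus, x) # w')"

lemma delete_pair_Cons: "delete_pair w w' \<Longrightarrow> delete_pair (p # w) (p # w')"
  by (metis append_Cons delete_pair.cases delete_pair.intros)

lemma delete_pairs_Cons: "delete_pair\<^sup>*\<^sup>* w w' \<Longrightarrow> delete_pair\<^sup>*\<^sup>* (p # w) (p # w')"
  by (induction rule: rtranclp_induct) (auto intro: delete_pair_Cons rtranclp.rtrancl_into_rtrancl)

lemma delete_pairs_reduce: "delete_pair\<^sup>*\<^sup>* w (reduce w)"
proof (induction w rule: reduce.induct)
  case (3 x w)
  have *: "delete_pair\<^sup>*\<^sup>* ((Minus, x) # w) ((Minus, x) # reduce w)"
    by (rule delete_pairs_Cons[OF 3])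
  have "delete_pair ((Minus, x) # (Plus, y) # w') w'" for y and w' :: "(sign \<times> 'a) list"
    using delete_pair.intros[of "[]"] by simp
  with * show ?case
    by (auto split: list.split sign.split intro: rtranclp.rtrancl_into_rtrancl)
qed (auto intro: delete_pairs_Cons)

lemma reduce_delete_pair: "delete_pair w w' \<Longrightarrow> reduce w = reduce w'"
proof (induction rule: delete_pair.induct)
  case (1 u x y v)
  show ?case
  proof (induction u)
    case (Cons p u)
    then show ?case by (cases p; cases "fst p") auto
  qed simp
qed

lemma reduce_irreducible: "\<not> (\<exists>w'. delete_pair w w') \<Longrightarrow> reduce w = w"
proof (induction w rule: reduce.induct)
  case (2 x w)
  then show ?case using delete_pair_Cons by fastforce
next
  case (3 x w)
  have "reduce w = w" using 3 delete_pair_Cons by blast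
  moreover have "w \<noteq> (Plus, y) # w'" for y w'
    using 3(2) delete_pair.intros[of "[]" x y w'] by auto
  ultimately show ?case by (auto split: list.split sign.split)
qed simp

lemma irreducible_reduce: "\<not> delete_pair (reduce w) w'"
proof (induction w arbitrary: w' rule: reduce.induct)
  case 1
  show ?case by (auto elim: delete_pair.cases)
next
  case (2 x w)
  then show ?case
    by (auto elim!: delete_pair.cases simp: Cons_eq_append_conv) (metis delete_pair.intros)
next
  case (3 x w)
  show ?case
  proof (cases "\<exists>y v. reduce w = (Plus, y) # v")
    case True
    then obtain y v where "reduce w = (Plus, y) # v" by blast
    then show ?thesis using 3 delete_pair_Cons by fastforce
  next
    case False
    then have "reduce ((Minus, x) # w) = (Minus, x) # reduce w"
      by (auto split: list.split sign.split)
    with False 3 show ?thesis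
      by (auto elim!: delete_pair.cases simp: Cons_eq_append_conv) (metis delete_pair.intros)
  qed
qed

lemma reduced_eq_reduce: "reduced w = reduce w"
  unfolding reduced_def
proof (rule the_equality)
  show "delete_pair\<^sup>*\<^sup>* w (reduce w) \<and> \<not> (\<exists>w''. delete_pair (reduce w) w'')"
    using delete_pairs_reduce irreducible_reduce by blast
next
  fix w' assume w': "delete_pair\<^sup>*\<^sup>* w w' \<and> \<not> (\<exists>w''. delete_pair w' w'')"
  then have "delete_pair\<^sup>*\<^sup>* w w'" by simp
  then have "reduce w = reduce w'"
    by (induction rule: rtranclp_induct) (auto dest: reduce_delete_pair)
  with w' show "w' = reduce w" by (simp add: reduce_irreducible)
qed

end

theory Submission
  imports Defs
begin

text \<open>
  Applying \<open>f_op\<close> or \<open>e_op\<close> flips a single letter of the signature, and this letter survives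
  the reduction. So each of the diagrams in question has a normal box \<open>x\<close> and two conormal boxes
  \<open>y1\<close>, \<open>y2\<close> with \<open>content y1 < content y2 < content x\<close>. In terms of the beads
  \<open>part D a - a\<close>, for which removing an \<open>l\<close>-rim hook moves a bead down by \<open>l\<close> and the hook is
  horizontal iff no bead is jumped over, there are beads at \<open>content x + 1\<close> and \<open>content y2\<close> and a
  gap at \<open>content y1 + 1\<close>. Sliding beads down the runner of \<open>content x + 1\<close> then eventually makes
  one of them jump over the bead at \<open>content y2\<close>, which is a non-horizontal \<open>l\<close>-rim hook.
\<close>

text \<open>Closure under single steps up and left extends to all steps by induction. In this form
  only pairs of neighbouring boxes have to be checked.\<close>

lemma is_partition_iff_local:
  "is_partition D \<longleftrightarrow> finite D \<and> (\<forall>a b. (Suc a, b) \<in> D \<longrightarrow> (a, b) \<in> D) \<and>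
     (\<forall>a b. (a, Suc b) \<in> D \<longrightarrow> (a, b) \<in> D)"
    (is "_ \<longleftrightarrow> finite D \<and> ?up \<and> ?left")
proof
  assume "is_partition D"
  then show "finite D \<and> ?up \<and> ?left"
    unfolding is_partition_def by (auto intro: le_SucI)
next
  assume local: "finite D \<and> ?up \<and> ?left"
  then have step: "(Suc a, b) \<in> D \<Longrightarrow> (a, b) \<in> D" "(a, Suc b) \<in> D \<Longrightarrow> (a, b) \<in> D" for a b
    by blast+
  have up: "(a + n, b) \<in> D \<Longrightarrow> (a, b) \<in> D" for a b n
  proof (induction n)
    case (Suc n)
    then show ?case using step(1)[of "a + n" b] by (metis add_Suc_right)
  qed simp
  have left: "(a, b + n) \<in> D \<Longrightarrow> (a, b) \<in> D" for a b n
  proof (induction n)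
    case (Suc n)
    then show ?case using step(2)[of a "b + n"] by (metis add_Suc_right)
  qed simp
  show "is_partition D"
    unfolding is_partition_def
  proof (intro conjI allI impI)
    show "finite D" using local by blast
    fix a b a' b' assume ab: "(a, b) \<in> D" "a' \<le> a" "b' \<le> b"
    then have "(a', b) \<in> D" using up[of a' "a - a'" b] by simp
    then show "(a', b') \<in> D" using left[of a' b' "b - b'"] ab(3) by simp
  qed
qed

subsection \<open>Beads\<close>

text \<open>These are the beta-numbers of charge 0. For a partition, \<open>bead D a\<close> is the
  content of the first free position of row \<open>a\<close>, and the empty rows put beads on all
  sufficiently small integers.\<close>

definition bead :: "diagram \<Rightarrow> nat \<Rightarrow> int" where
  "bead D a = int (part D a) - int a"

lemma mem_iff_less_part:
  assumes "is_partition D"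
  shows "(a, b) \<in> D \<longleftrightarrow> b < part D a"
proof -
  let ?S = "{b. (a, b) \<in> D}"
  have "?S \<subseteq> snd ` D" by force
  then have fin: "finite ?S"
    using assms finite_surj[of D ?S snd] by (auto simp: is_partition_def)
  have down: "b' \<in> ?S" if "b \<in> ?S" "b' \<le> b" for b b'
    using assms that by (auto simp: is_partition_def)
  show ?thesis
  proof
    assume "(a, b) \<in> D"
    then have "{..b} \<subseteq> ?S" using down by blast
    from card_mono[OF fin this] show "b < part D a" by (simp add: part_def)
  next
    assume less: "b < part D a"
    show "(a, b) \<in> D"
    proof (rule ccontr)
      assume "(a, b) \<notin> D"
      then have "?S \<subseteq> {..<b}" using down[of _ b] by (auto simp: not_le[symmetric])
      from card_mono[OF _ this] show False using less by (simp add: part_def)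
    qed
  qed
qed

lemma part_antimono:
  assumes "is_partition D" "a \<le> a'"
  shows "part D a' \<le> part D a"
proof (rule ccontr)
  assume "\<not> part D a' \<le> part D a"
  then have "(a', part D a) \<in> D" by (simp add: mem_iff_less_part assms)
  then have "(a, part D a) \<in> D" using assms by (auto simp: is_partition_def)
  then show False by (simp add: mem_iff_less_part assms)
qed

lemma bead_strict_antimono:
  assumes "is_partition D" "a < a'"
  shows "bead D a' < bead D a"
  using part_antimono[of D a a'] assms by (simp add: bead_def)

lemma bead_antimono:
  assumes "is_partition D" "a \<le> a'"
  shows "bead D a' \<le> bead D a"
  using part_antimono[of D a a'] assms by (simp add: bead_def)

lemma bead_less_iff:
  assumes "is_partition D"
  shows "bead D a < bead D a' \<longleftrightarrow> a' < a"
  using bead_antimono[OF assms] bead_strict_antimono[OF assms] by (meson not_le)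

lemma mem_iff_content_less_bead:
  assumes "is_partition D"
  shows "x \<in> D \<longleftrightarrow> content x < bead D (fst x)"
  using mem_iff_less_part[OF assms, of "fst x" "snd x"]
  by (auto simp: content_def bead_def)

lemma bead_below_ground:
  assumes "is_partition D" "part D r = 0" "n \<le> - int r"
  shows "n \<in> range (bead D)"
proof -
  have "part D (nat (- n)) = 0" using part_antimono[of D r "nat (- n)"] assms by simp
  then have "bead D (nat (- n)) = n" using assms by (simp add: bead_def)
  then show ?thesis by (metis rangeI)
qed

subsection \<open>The rim hook of a bead move\<close>

text \<open>For a partition the last two conditions say that the box is in \<open>D\<close> and its
  lower right diagonal neighbour is not: this is the rim between contents \<open>g\<close> and
  \<open>m - 1\<close>.\<close>

definition rim_segment :: "diagram \<Rightarrow> int \<Rightarrow> int \<Rightarrow> box set" where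
  "rim_segment D g m = {x. g \<le> content x \<and> content x < m \<and>
     bead D (Suc (fst x)) \<le> content x \<and> content x < bead D (fst x)}"

text \<open>The box lies in the last row whose bead exceeds \<open>k\<close>. Its column is not
  negative, since otherwise the rows below would be empty and \<open>g\<close> would be one of their
  beads.\<close>

lemma rim_segment_ex:
  assumes D: "is_partition D" and g: "g \<notin> range (bead D)" and k: "g \<le> k" "k < bead D a"
  shows "\<exists>x\<in>rim_segment D g (bead D a). content x = k"
proof -
  define n where "n = (LEAST n. bead D n \<le> k)"
  have "bead D (nat (bead D 0 - k)) \<le> k"
    using part_antimono[OF D, of 0 "nat (bead D 0 - k)"] by (simp add: bead_def)
  then have n: "bead D n \<le> k" unfolding n_def by (rule LeastI)
  have "n \<noteq> 0" using n k bead_antimono[OF D, of 0 a] by (metis le_zero_eq linorder_not_le nat_le_linear order_trans)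
  then obtain r where r: "n = Suc r" by (cases n) auto
  then have less: "k < bead D r" using not_less_Least[of r "\<lambda>n. bead D n \<le> k"] n_def by auto
  have "0 \<le> k + int r"
  proof (rule ccontr)
    assume neg: "\<not> 0 \<le> k + int r"
    with n r have "part D (Suc r) = 0" by (simp add: bead_def)
    moreover have "g \<le> - int (Suc r)" using neg k by simp
    ultimately show False using bead_below_ground[OF D] g by blast
  qed
  then have "content (r, nat (k + int r)) = k" by (simp add: content_def)
  then show ?thesis using n r less k by (intro bexI[of _ "(r, nat (k + int r))"]) (auto simp: rim_segment_def)
qed

text \<open>The half-open intervals between consecutive beads are disjoint, so the content of a rim
  box determines its row.\<close>

lemma rim_segment_row_eq:
  assumes D: "is_partition D" and "x \<in> rim_segment D g m" "bead D (Suc r) \<le> content x" "content x < bead D r"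
  shows "fst x = r"
proof -
  have "bead D (Suc r) < bead D (fst x)" "bead D (Suc (fst x)) < bead D r"
    using assms by (auto simp: rim_segment_def)
  then show ?thesis by (simp add: bead_less_iff[OF D])
qed

lemma rim_segment_inj: "is_partition D \<Longrightarrow> inj_on content (rim_segment D g m)"
proof (rule inj_onI)
  fix x y assume D: "is_partition D" and xy: "x \<in> rim_segment D g m" "y \<in> rim_segment D g m" "content x = content y"
  then have "fst x = fst y"
    by (intro rim_segment_row_eq[OF D xy(1)]) (auto simp: rim_segment_def)
  then show "x = y" using xy(3) by (auto simp: content_def prod_eq_iff)
qed

text \<open>The rim continues to the right until the row ends; then \<open>content y\<close> is the
  bead of that row and \<open>y\<close> sits directly above \<open>x\<close>.\<close>

lemma rim_segment_adjacent:
  assumes D: "is_partition D" and x: "x \<in> rim_segment D g m" and y: "y \<in> rim_segment D g m"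
    and xy: "content y = content x + 1"
  shows "adjacent x y"
proof (cases "content y < bead D (fst x)")
  case True
  then have "fst y = fst x"
    using x xy by (intro rim_segment_row_eq[OF D y]) (auto simp: rim_segment_def)
  then show ?thesis using xy by (auto simp: adjacent_def content_def)
next
  case False
  then have eq: "content y = bead D (fst x)" using x xy by (auto simp: rim_segment_def)
  have "bead D (fst x) < bead D (fst y)" using y eq by (auto simp: rim_segment_def)
  then have less: "fst y < fst x" by (simp add: bead_less_iff[OF D])
  have "\<not> bead D (fst x) < bead D (Suc (fst y))" using y eq by (auto simp: rim_segment_def)
  then have "fst x = Suc (fst y)" using less by (simp add: bead_less_iff[OF D])
  then show ?thesis using xy by (auto simp: adjacent_def content_def)
qed

text \<open>All contents between those of two boxes are taken, and boxes of consecutive content are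
  adjacent.\<close>

lemma rim_segment_connected:
  assumes D: "is_partition D" and g: "g \<notin> range (bead D)"
  shows "connected_boxes (rim_segment D g (bead D a))"
proof -
  let ?R = "rim_segment D g (bead D a)"
  define step where "step = (\<lambda>u v. u \<in> ?R \<and> v \<in> ?R \<and> adjacent u v)"
  have up: "step\<^sup>*\<^sup>* x y \<and> step\<^sup>*\<^sup>* y x" if "x \<in> ?R" "y \<in> ?R" "content y = content x + int n" for x y n
    using that
  proof (induction n arbitrary: y)
    case 0
    then have "x = y" using rim_segment_inj[OF D] by (metis add.right_neutral inj_onD of_nat_0)
    then show ?case by simp
  next
    case (Suc n)
    have "g \<le> content x + int n" "content x + int n < bead D a"
      using Suc.prems by (auto simp: rim_segment_def)
    then obtain z where z: "z \<in> ?R" "content z = content x + int n"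
      using rim_segment_ex[OF D g] by blast
    have "adjacent z y" using Suc.prems z by (intro rim_segment_adjacent[OF D]) auto
    then have "adjacent y z" by (auto simp: adjacent_def)
    have "step z y" "step y z"
      using \<open>adjacent z y\<close> \<open>adjacent y z\<close> z Suc.prems by (auto simp: step_def)
    then show ?case using Suc.IH[OF Suc.prems(1) z]
      by (meson converse_rtranclp_into_rtranclp rtranclp.rtrancl_into_rtrancl)
  qed
  have "step\<^sup>*\<^sup>* x y" if "x \<in> ?R" "y \<in> ?R" for x y
  proof (cases "content x \<le> content y")
    case True
    then show ?thesis using up[OF that, of "nat (content y - content x)"] by simp
  next
    case False
    then show ?thesis using up[OF that(2,1), of "nat (content x - content y)"] by simp
  qed
  then show ?thesis by (simp add: connected_boxes_def step_def)
qed

lemma rim_segment_not_square: "is_partition D \<Longrightarrow> \<not> has_square (rim_segment D g m)"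
  by (auto simp: has_square_def rim_segment_def content_def)

lemma is_partition_Diff:
  assumes D: "is_partition D"
    and right: "\<And>a b. (a, b) \<in> R \<Longrightarrow> (a, Suc b) \<in> D \<Longrightarrow> (a, Suc b) \<in> R"
    and below: "\<And>a b. (a, b) \<in> R \<Longrightarrow> (Suc a, b) \<in> D \<Longrightarrow> (Suc a, b) \<in> R"
  shows "is_partition (D - R)"
  unfolding is_partition_iff_local
proof (intro conjI allI impI)
  note local = D[unfolded is_partition_iff_local]
  show "finite (D - R)" using local by blast
  show "(a, b) \<in> D - R" if "(Suc a, b) \<in> D - R" for a b
    using that below[of a b] local by blast
  show "(a, b) \<in> D - R" if "(a, Suc b) \<in> D - R" for a b
    using that right[of a b] local by blast
qed

text \<open>At the upper end, a right neighbour left behind would put \<open>bead D a\<close>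
  strictly between two consecutive beads. At the lower end, a segment box with a box of
  \<open>D\<close> below it has a bead at its content, so this content is not the gap
  \<open>g\<close>.\<close>

lemma rim_segment_partition:
  assumes D: "is_partition D" and g: "g \<notin> range (bead D)"
  shows "is_partition (D - rim_segment D g (bead D a))"
proof (rule is_partition_Diff[OF D])
  fix r j assume x: "(r, j) \<in> rim_segment D g (bead D a)"
  {
    assume "(r, Suc j) \<in> D"
    then have less: "content (r, j) + 1 < bead D r"
      by (simp add: mem_iff_content_less_bead[OF D] content_def)
    have "content (r, j) + 1 \<noteq> bead D a"
    proof
      assume eq: "content (r, j) + 1 = bead D a"
      have "bead D (Suc r) < bead D a" "bead D a < bead D r"
        using eq less x by (auto simp: rim_segment_def)
      then show False by (simp add: bead_less_iff[OF D])
    qed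
    then show "(r, Suc j) \<in> rim_segment D g (bead D a)"
      using x less by (auto simp: rim_segment_def content_def)
  }
  {
    assume "(Suc r, j) \<in> D"
    then have less: "content (r, j) - 1 < bead D (Suc r)"
      by (simp add: mem_iff_content_less_bead[OF D] content_def)
    then have "content (r, j) = bead D (Suc r)" using x by (auto simp: rim_segment_def)
    moreover from this have "content (r, j) \<noteq> g" using g by auto
    ultimately show "(Suc r, j) \<in> rim_segment D g (bead D a)"
      using x bead_strict_antimono[OF D, of "Suc r" "Suc (Suc r)"]
      by (auto simp: rim_segment_def content_def)
  }
qed

text \<open>The contents run once through \<open>l\<close> consecutive integers, which gives the
  size of the hook.\<close>

lemma rim_segment_rim_hook:
  assumes D: "is_partition D" and g: "bead D a - int l \<notin> range (bead D)"
  shows "rim_hook l D (rim_segment D (bead D a - int l) (bead D a))"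
proof -
  let ?R = "rim_segment D (bead D a - int l) (bead D a)"
  have "content ` ?R = {bead D a - int l..<bead D a}"
    using rim_segment_ex[OF D g, of _ a] by (fastforce simp: rim_segment_def image_iff)
  then have "card ?R = l"
    using card_image[OF rim_segment_inj[OF D]] by (metis card_atLeastLessThan_int diff_diff_eq2
      add_diff_cancel_left' nat_int)
  moreover have "?R \<subseteq> D" by (auto simp: rim_segment_def mem_iff_content_less_bead[OF D])
  ultimately show ?thesis
    unfolding rim_hook_def
    using rim_segment_connected[OF D g] rim_segment_not_square[OF D] rim_segment_partition[OF D g]
    by blast
qed

lemma part_Diff_row:
  assumes "R \<subseteq> D" "finite R" and row: "\<And>x. x \<in> R \<Longrightarrow> fst x = a"
  shows "part (D - R) s = (if s = a then part D s - card R else part D s)"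
proof (cases "s = a")
  case True
  have "snd ` R = {b. (a, b) \<in> R}"
  proof (intro set_eqI iffI)
    fix b assume "b \<in> snd ` R"
    then obtain x where x: "x \<in> R" "b = snd x" by blast
    then have "x = (a, b)" using row[of x] by (simp add: prod_eq_iff)
    then show "b \<in> {b. (a, b) \<in> R}" using x by simp
  qed force
  moreover have "card (snd ` R) = card R" by (intro card_image inj_onI prod_eqI) (simp_all add: row)
  moreover have "{b. (a, b) \<in> D - R} = {b. (a, b) \<in> D} - {b. (a, b) \<in> R}" by auto
  moreover have "{b. (a, b) \<in> R} \<subseteq> {b. (a, b) \<in> D}" using assms(1) by auto
  ultimately show ?thesis
    using True finite_imageI[OF assms(2), of snd] by (simp add: part_def card_Diff_subset)
next
  case False
  then have "(s, b) \<notin> R" for b using row[of "(s, b)"] by auto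
  then have "{b. (s, b) \<in> D - R} = {b. (s, b) \<in> D}" by simp
  then show ?thesis using False by (simp add: part_def)
qed

subsection \<open>Bead configurations of l-partitions\<close>

text \<open>A condition inherited by every diagram reached by removing horizontal hooks, as an
  induction along bead moves requires.\<close>

definition only_horizontal :: "nat \<Rightarrow> diagram \<Rightarrow> bool" where
  "only_horizontal l D \<longleftrightarrow> is_partition D \<and>
     (\<forall>E. (remove_horizontal l)\<^sup>*\<^sup>* D E \<longrightarrow> (\<forall>R. rim_hook l E R \<longrightarrow> horizontal R))"

lemma l_partition_only_horizontal: "l_partition l D \<Longrightarrow> only_horizontal l D"
  by (simp add: l_partition_def only_horizontal_def)

text \<open>The hook of this move must be horizontal, while a bead jumped over would put one of its
  boxes into another row. Removing it shortens a single row by \<open>l\<close>, so only one bead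
  moves.\<close>

lemma only_horizontal_move:
  assumes l: "0 < l" and D: "only_horizontal l D"
    and n: "n \<in> range (bead D)" "n - int l \<notin> range (bead D)"
  shows "range (bead D) \<inter> {n - int l<..<n} = {}"
    and "\<exists>E. only_horizontal l E \<and> range (bead E) = insert (n - int l) (range (bead D) - {n})"
proof -
  have P: "is_partition D" using D by (simp add: only_horizontal_def)
  obtain a where a: "n = bead D a" using n by blast
  let ?R = "rim_segment D (n - int l) n"
  have hook: "rim_hook l D ?R" using rim_segment_rim_hook[OF P] n a by blast
  then have "horizontal ?R" using D by (auto simp: only_horizontal_def)
  then obtain r where r: "\<And>x. x \<in> ?R \<Longrightarrow> fst x = r" by (auto simp: horizontal_def)
  \<comment> \<open>The rim box of content \<open>bead D s - 1\<close> lies in row \<open>s\<close>,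
    so all beads in this range belong to the one row of the hook.\<close>
  have row: "s = a" if s: "n - int l < bead D s" "bead D s \<le> n" for s
  proof -
    have "fst x = s" if "x \<in> ?R" "content x = bead D s - 1" for x s
      using bead_strict_antimono[OF P, of s "Suc s"] that
      by (intro rim_segment_row_eq[OF P that(1)]) auto
    then have "s = r" if "n - int l < bead D s" "bead D s \<le> n" for s
      using rim_segment_ex[OF P n(2), of "bead D s - 1" a] that a r by force
    from this[of s] this[of a] show ?thesis using s l a by auto
  qed
  then show no_bead: "range (bead D) \<inter> {n - int l<..<n} = {}" using a by fastforce
  have "r = a"
    using rim_segment_ex[OF P n(2), of "n - 1" a] a l r bead_strict_antimono[OF P, of a "Suc a"]
      rim_segment_row_eq[OF P, of _ "n - int l" n a] by fastforce
  let ?E = "D - ?R"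
  have E: "is_partition ?E" using hook by (simp add: rim_hook_def)
  have "(remove_horizontal l) D ?E" using hook \<open>horizontal ?R\<close> by (auto simp: remove_horizontal_def)
  then have "only_horizontal l ?E"
    using D E by (auto simp: only_horizontal_def intro: converse_rtranclp_into_rtranclp)
  moreover have "bead ?E s = (if s = a then n - int l else bead D s)" for s
  proof -
    have "finite ?R" using hook l by (metis card.infinite not_less0 rim_hook_def)
    then have "part ?E s = (if s = a then part D s - l else part D s)"
      using part_Diff_row[of ?R D a s] hook r \<open>r = a\<close> by (auto simp: rim_hook_def)
    \<comment> \<open>This makes the truncated subtraction \<open>part D s - l\<close> exact for
      \<open>s = a\<close>; the leftmost box of the hook provides it.\<close>
    moreover have "l \<le> part D a"
    proof -
      obtain x where x: "x \<in> ?R" "content x = n - int l"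
        using rim_segment_ex[OF P n(2), of "n - int l" a] a l by auto
      then have "fst x = a" using r \<open>r = a\<close> by blast
      then show ?thesis using x a by (auto simp: content_def bead_def)
    qed
    ultimately show ?thesis using a by (simp add: bead_def)
  qed
  moreover have "bead D s = n \<longleftrightarrow> s = a" for s
    using a bead_less_iff[OF P] by (metis linorder_neqE_nat order_less_irrefl)
  ultimately have "range (bead ?E) = insert (n - int l) (range (bead D) - {n})"
    by (auto simp: image_iff)
  then show "\<exists>E. only_horizontal l E \<and> range (bead E) = insert (n - int l) (range (bead D) - {n})"
    using \<open>only_horizontal l ?E\<close> by blast
qed

text \<open>Induction on \<open>m - g\<close>: first the bead at \<open>m\<close> comes down to \<open>b + 1\<close>, then the gap at \<open>g\<close>
  goes up to \<open>b + 1 - l\<close>, and the next move jumps over \<open>b\<close>.\<close>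

lemma not_only_horizontal:
  assumes l: "2 \<le> l" and "only_horizontal l D"
    and "b \<in> range (bead D)" "m \<in> range (bead D)" "g \<notin> range (bead D)"
    and "g < b" "b < m" "m mod int l = (b + 1) mod int l" "g mod int l = (b + 1) mod int l"
  shows False
  using assms(2-)
proof (induction "nat (m - g)" arbitrary: D m g rule: less_induct)
  case less
  have near: "x = y" if "x mod int l = y mod int l" "y \<le> x" "x < y + int l" for x y :: int
    using that by (smt (verit) mod_eq_dvd_iff zdvd_not_zless)
  \<comment> \<open>The bead at \<open>b\<close> is off the runner of \<open>b + 1\<close> because
    \<open>2 \<le> l\<close>, so no move along that runner starts or ends at it.\<close>
  have "b mod int l \<noteq> (b + 1) mod int l" using near[of "b + 1" b] l by auto
  then have b: "b \<noteq> x" "b \<noteq> x - int l" if "x mod int l = (b + 1) mod int l" for x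
    using that by (auto simp: mod_diff_right_eq)
  show False
  proof (cases "m = b + 1")
    case False
    then have "b < m - int l" using near[OF less.prems(7)] less.prems(6) by linarith
    show False
    proof (cases "m - int l \<in> range (bead D)")
      case True
      then show False using less.hyps[of "m - int l" g D] less.prems \<open>b < m - int l\<close> l by simp
    next
      case False
      \<comment> \<open>The gap at \<open>g\<close> survives this move, since
        \<open>g < b < m - int l\<close>.\<close>
      then obtain E where E: "only_horizontal l E"
        "range (bead E) = insert (m - int l) (range (bead D) - {m})"
        using only_horizontal_move(2)[of l D m] less.prems l by auto
      show False using less.hyps[of "m - int l" g E] E less.prems \<open>b < m - int l\<close> l b by simp
    qed
  next
    case True
    have up: "g + int l \<le> m" using near[of m g] less.prems True by linarith
    show False
    proof (cases "g + int l = m")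
      case True
      then have "m - int l = g" by simp
      then have "b \<in> range (bead D) \<inter> {m - int l<..<m}" "m - int l \<notin> range (bead D)"
        using less.prems by simp_all
      then show False using only_horizontal_move(1)[of l D m] less.prems(1,3) l by fastforce
    next
      case False
      have gb: "g + int l < b" using False up True b[of "g + int l"] less.prems by auto
      show False
      proof (cases "g + int l \<in> range (bead D)")
        case False
        then show False using less.hyps[of m "g + int l" D] less.prems gb l by simp
      next
        case True
        \<comment> \<open>The bead at \<open>g + int l\<close> drops into \<open>g\<close>, which
          raises the gap by \<open>l\<close>; the beads at \<open>b\<close> and \<open>m\<close>
          stay.\<close>
        then obtain E where E: "only_horizontal l E"
          "range (bead E) = insert g (range (bead D) - {g + int l})"
          using only_horizontal_move(2)[of l D "g + int l"] less.prems l by auto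
        show False using less.hyps[of m "g + int l" E] E less.prems gb l by simp
      qed
    qed
  qed
qed

subsection \<open>Signatures\<close>

text \<open>Adding and removing a box become one involution, so that \<open>f_op\<close> and
  \<open>e_op\<close> can be treated alike.\<close>

definition toggle :: "box \<Rightarrow> diagram \<Rightarrow> diagram" where
  "toggle x D = (if x \<in> D then D - {x} else insert x D)"

lemma mem_toggle: "z \<in> toggle x D \<longleftrightarrow> (z \<in> D) \<noteq> (z = x)"
  by (auto simp: toggle_def)

lemma toggle_toggle: "toggle x (toggle x D) = D"
  by (auto simp: mem_toggle)

text \<open>The conditions of the local criterion for partitions involve pairs of adjacent boxes, and
  no such pair is \<open>{x, y}\<close>.\<close>

lemma is_partition_toggle:
  assumes "is_partition D" "is_partition (toggle x D)" "is_partition (toggle y D)" "\<not> adjacent x y"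
  shows "is_partition (toggle y (toggle x D))"
proof (cases "x = y")
  case True
  then show ?thesis using assms by (simp add: toggle_toggle)
next
  case False
  have fin: "finite (toggle y (toggle x D))" using assms(1) by (auto simp: is_partition_def toggle_def)
  have pair: "v \<in> toggle y (toggle x D)" if "u \<in> toggle y (toggle x D)"
    and "u \<in> D \<longrightarrow> v \<in> D" "u \<in> toggle x D \<longrightarrow> v \<in> toggle x D" "u \<in> toggle y D \<longrightarrow> v \<in> toggle y D"
    and "adjacent u v" for u v
  proof -
    have "\<not> adjacent y x" using assms(4) by (auto simp: adjacent_def)
    \<comment> \<open>Hence at most one of the two toggles touches the pair \<open>u\<close>,
      \<open>v\<close>, and on this pair the double toggle agrees with \<open>D\<close>,
      \<open>toggle x D\<close> or \<open>toggle y D\<close>.\<close>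
    then have "{u, v} \<noteq> {x, y}" using assms(4) that(5) by (auto simp: doubleton_eq_iff)
    moreover have "u \<noteq> v" using that(5) by (auto simp: adjacent_def)
    ultimately show ?thesis using that(1-4) False unfolding mem_toggle by blast
  qed
  note local = assms(1-3)[unfolded is_partition_iff_local]
  show ?thesis
    unfolding is_partition_iff_local
  proof (intro conjI allI impI)
    fix a b
    have adj: "adjacent (Suc a, b) (a, b)" "adjacent (a, Suc b) (a, b)"
      by (simp_all add: adjacent_def)
    show "(a, b) \<in> toggle y (toggle x D)" if "(Suc a, b) \<in> toggle y (toggle x D)"
      by (rule pair[OF that]) (use local adj in blast)+
    show "(a, b) \<in> toggle y (toggle x D)" if "(a, Suc b) \<in> toggle y (toggle x D)"
      by (rule pair[OF that]) (use local adj in blast)+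
  qed (rule fin)
qed

text \<open>Addable and removable boxes are kept together because toggling one of them leaves the
  union unchanged, as \<open>moves_toggle\<close> shows.\<close>

definition moves :: "nat \<Rightarrow> int \<Rightarrow> diagram \<Rightarrow> box set" where
  "moves l i D = {x. residue l x = i \<and> is_partition (toggle x D)}"

lemma moves_eq: "{x. removable l i D x \<or> addable l i D x} = moves l i D"
  by (auto simp: moves_def removable_def addable_def toggle_def)

lemma not_adjacent_same_residue:
  assumes "2 \<le> l" "residue l x = residue l y"
  shows "\<not> adjacent x y"
proof
  assume "adjacent x y"
  then have "content x = content y + 1 \<or> content y = content x + 1"
    by (auto simp: adjacent_def content_def)
  moreover have "int l dvd content x - content y"
    using assms(2) by (simp add: residue_def mod_eq_dvd_iff)
  ultimately have "int l dvd 1" by (auto simp: dvd_diff_commute)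
  then show False using assms(1) by simp
qed

text \<open>Boxes of equal residue are never adjacent, so their toggles do not interfere. This gives
  one inclusion, and the same argument for the toggled diagram gives the other.\<close>

lemma moves_toggle:
  assumes l: "2 \<le> l" and D: "is_partition D" and x: "x \<in> moves l i D"
  shows "moves l i (toggle x D) = moves l i D"
proof -
  have sub: "moves l i D' \<subseteq> moves l i (toggle x D')"
    if "is_partition D'" "x \<in> moves l i D'" for D'
    using that is_partition_toggle[OF that(1), of x] not_adjacent_same_residue[OF l, of x]
    by (auto simp: moves_def)
  have "x \<in> moves l i (toggle x D)" "is_partition (toggle x D)"
    using D x by (auto simp: moves_def toggle_toggle)
  then show ?thesis using sub[of D] sub[of "toggle x D"] D x by (auto simp: toggle_toggle)
qed

text \<open>The lower box belongs to \<open>D\<close> or to its toggle, both partitions, and the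
  toggle does not affect the box above.\<close>

lemma moves_above:
  assumes D: "is_partition D" and "(Suc a, b) \<in> moves l i D"
  shows "(a, b) \<in> D"
proof -
  have P: "is_partition (toggle (Suc a, b) D)" using assms by (simp add: moves_def)
  have "(Suc a, b) \<in> D \<or> (Suc a, b) \<in> toggle (Suc a, b) D" by (simp add: mem_toggle)
  then have "(a, b) \<in> D \<or> (a, b) \<in> toggle (Suc a, b) D"
    using D P unfolding is_partition_iff_local by blast
  then show ?thesis by (simp add: mem_toggle)
qed

lemma moves_left:
  assumes D: "is_partition D" and "(a, Suc b) \<in> moves l i D"
  shows "(a, b) \<in> D"
proof -
  have P: "is_partition (toggle (a, Suc b) D)" using assms by (simp add: moves_def)
  have "(a, Suc b) \<in> D \<or> (a, Suc b) \<in> toggle (a, Suc b) D" by (simp add: mem_toggle)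
  then have "(a, b) \<in> D \<or> (a, b) \<in> toggle (a, Suc b) D"
    using D P unfolding is_partition_iff_local by blast
  then show ?thesis by (simp add: mem_toggle)
qed

lemma finite_moves:
  assumes "is_partition D"
  shows "finite (moves l i D)"
proof -
  have "moves l i D \<subseteq> insert (0, 0) (D \<union> (\<lambda>(a, b). (Suc a, b)) ` D \<union> (\<lambda>(a, b). (a, Suc b)) ` D)"
  proof
    fix x assume x: "x \<in> moves l i D"
    show "x \<in> insert (0, 0) (D \<union> (\<lambda>(a, b). (Suc a, b)) ` D \<union> (\<lambda>(a, b). (a, Suc b)) ` D)"
    proof (cases x)
      case (Pair a b)
      show ?thesis
      proof (cases a)
        case (Suc a')
        then have "(a', b) \<in> D" using x Pair moves_above[OF assms] by simp
        from imageI[OF this, of "\<lambda>(a, b). (Suc a, b)"] show ?thesis using Pair Suc by simp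
      next
        case 0
        show ?thesis
        proof (cases b)
          case (Suc b')
          then have "(a, b') \<in> D" using x Pair moves_left[OF assms] by simp
          from imageI[OF this, of "\<lambda>(a, b). (a, Suc b)"] show ?thesis using Pair Suc by simp
        qed (simp add: Pair 0)
      qed
    qed
  qed
  moreover have "finite D" using assms by (simp add: is_partition_def)
  ultimately show ?thesis by (auto intro: finite_subset)
qed

text \<open>Of two such boxes on one diagonal, the lower forces the right neighbour of the upper
  into \<open>D\<close>; then the upper box is in \<open>D\<close> and cannot be removed.\<close>

lemma inj_on_content_moves:
  assumes D: "is_partition D"
  shows "inj_on content (moves l i D)"
proof -
  have False if x: "(a, b) \<in> moves l i D" and y: "(a + d, b + d) \<in> moves l i D" and "0 < d" for a b d
  proof -
    obtain e where e: "d = Suc e" using \<open>0 < d\<close> by (cases d) auto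
    have "(a + e, b + d) \<in> D" using moves_above[OF D, of "a + e"] y e by simp
    moreover have "a \<le> a + e" "Suc b \<le> b + d" using e by auto
    ultimately have "(a, Suc b) \<in> D" using D unfolding is_partition_def by blast
    moreover from this have "(a, b) \<in> D" using D unfolding is_partition_iff_local by blast
    moreover have "is_partition (toggle (a, b) D)" using x by (simp add: moves_def)
    then have "(a, Suc b) \<in> toggle (a, b) D \<longrightarrow> (a, b) \<in> toggle (a, b) D"
      unfolding is_partition_iff_local by blast
    ultimately show False by (simp add: mem_toggle)
  qed
  note diagonal = this
  have le: "x = y" if xy: "x \<in> moves l i D" "y \<in> moves l i D" "content x = content y" "fst x \<le> fst y" for x y
  proof (cases "fst x = fst y")
    case True
    then show ?thesis using xy by (auto simp: content_def prod_eq_iff)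
  next
    case False
    have "y = (fst x + (fst y - fst x), snd x + (fst y - fst x))"
      using xy by (auto simp: content_def prod_eq_iff)
    then show ?thesis using diagonal[of "fst x" "snd x" "fst y - fst x"] xy False by simp
  qed
  show ?thesis by (rule inj_onI) (metis le nat_le_linear)
qed

text \<open>The library facts live in a locale whose key is injective on a fixed carrier; here the
  carrier is \<open>A\<close> itself.\<close>

lemma (in linorder)
  assumes "inj_on f A"
  shows set_sorted_key_list_of_set_inj_on: "finite A \<Longrightarrow> set (sorted_key_list_of_set f A) = A"
    and sorted_key_list_of_set_inj_on: "sorted_wrt (<) (map f (sorted_key_list_of_set f A))"
proof -
  interpret folding_insort_key "(\<le>)" "(<)" A f
    by standard (rule assms)
  show "finite A \<Longrightarrow> set (sorted_key_list_of_set f A) = A"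
    by (rule set_sorted_key_list_of_set) simp_all
  show "sorted_wrt (<) (map f (sorted_key_list_of_set f A))"
    by (rule strict_sorted_key_list_of_set) simp
qed

lemma signature_eq:
  "signature l i D = map (\<lambda>x. (if x \<in> D then Minus else Plus, x))
     (sorted_key_list_of_set content (moves l i D))"
  by (simp add: signature_def moves_eq)

lemma
  assumes "is_partition D"
  shows set_signature: "set (signature l i D) = (\<lambda>x. (if x \<in> D then Minus else Plus, x)) ` moves l i D"
    and sorted_signature: "sorted_wrt (\<lambda>p q. content (snd p) < content (snd q)) (signature l i D)"
proof -
  note key = inj_on_content_moves[OF assms, of l i] finite_moves[OF assms, of l i]
  show "set (signature l i D) = (\<lambda>x. (if x \<in> D then Minus else Plus, x)) ` moves l i D"
    by (simp add: signature_eq set_sorted_key_list_of_set_inj_on[OF key])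
  show "sorted_wrt (\<lambda>p q. content (snd p) < content (snd q)) (signature l i D)"
    using sorted_key_list_of_set_inj_on[OF key(1)] by (simp add: signature_eq sorted_wrt_map)
qed

definition flip :: "'a \<Rightarrow> sign \<times> 'a \<Rightarrow> sign \<times> 'a" where
  "flip z p = (if snd p = z then (if fst p = Plus then Minus else Plus, z) else p)"

lemma signature_toggle:
  assumes "2 \<le> l" "is_partition D" "x \<in> moves l i D"
  shows "signature l i (toggle x D) = map (flip x) (signature l i D)"
  by (auto simp: signature_eq moves_toggle[OF assms] flip_def mem_toggle)

subsection \<open>Reduced signatures\<close>

lemma delete_pairs_sorted_wrt: "delete_pair\<^sup>*\<^sup>* w u \<Longrightarrow> sorted_wrt P w \<Longrightarrow> sorted_wrt P u"
  by (induction rule: rtranclp_induct) (auto simp: sorted_wrt_append elim!: delete_pair.cases)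

lemma delete_pairs_set: "delete_pair\<^sup>*\<^sup>* w u \<Longrightarrow> set u \<subseteq> set w"
  by (induction rule: rtranclp_induct) (auto elim!: delete_pair.cases)

lemma delete_pairs_distinct: "delete_pair\<^sup>*\<^sup>* w u \<Longrightarrow> distinct (map snd w) \<Longrightarrow> distinct (map snd u)"
  by (induction rule: rtranclp_induct) (auto elim!: delete_pair.cases)

lemma reduce_delete_pairs: "delete_pair\<^sup>*\<^sup>* w u \<Longrightarrow> reduce w = reduce u"
  by (induction rule: rtranclp_induct) (auto dest: reduce_delete_pair)

text \<open>The surviving letter is not in the deleted pair, so the same deletion is possible after
  the flip. Distinctness ensures that no deleted letter carries the box \<open>z\<close>.\<close>

lemma delete_pair_flip:
  assumes "delete_pair w u" "distinct (map snd w)" "z \<in> snd ` set u"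
  shows "delete_pair (map (flip z) w) (map (flip z) u)"
  using assms(1)
proof cases
  case (1 v x y v')
  then have "x \<noteq> z" "y \<noteq> z" using assms(2,3) by auto
  then show ?thesis using 1 by (auto simp: flip_def intro: delete_pair.intros)
qed

lemma delete_pairs_flip:
  assumes "delete_pair\<^sup>*\<^sup>* w u" "distinct (map snd w)" "z \<in> snd ` set u"
  shows "delete_pair\<^sup>*\<^sup>* (map (flip z) w) (map (flip z) u)"
  using assms
proof (induction rule: rtranclp_induct)
  case (step v u)
  have "z \<in> snd ` set v" using delete_pairs_set[of v u] step by blast
  then show ?case
    using step delete_pair_flip[of v u z] delete_pairs_distinct[of w v] by auto
qed simp

text \<open>A new leading \<open>Minus\<close> cancels the first \<open>Plus\<close> that is left,
  or else there is none and it starts the block of \<open>Minus\<close> letters.\<close>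

lemma reduce_shape: "\<exists>ps ms. reduce w = map (Pair Plus) ps @ map (Pair Minus) ms"
proof (induction w rule: reduce.induct)
  case 1
  show ?case by simp
next
  case (2 x w)
  then obtain ps ms where "reduce w = map (Pair Plus) ps @ map (Pair Minus) ms" by blast
  then have "reduce ((Plus, x) # w) = map (Pair Plus) (x # ps) @ map (Pair Minus) ms" by simp
  then show ?case by blast
next
  case (3 x w)
  then obtain ps ms where w: "reduce w = map (Pair Plus) ps @ map (Pair Minus) ms" by blast
  show ?case
  proof (cases ps)
    case Nil
    then have "reduce ((Minus, x) # w) = map (Pair Plus) [] @ map (Pair Minus) (x # ms)"
      using w by (auto split: list.split)
    then show ?thesis by blast
  next
    case (Cons p ps')
    then have "reduce ((Minus, x) # w) = map (Pair Plus) ps' @ map (Pair Minus) ms"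
      using w by simp
    then show ?thesis by blast
  qed
qed

lemma reduce_of_shape:
  "reduce (map (Pair Plus) ps @ map (Pair Minus) ms) = map (Pair Plus) ps @ map (Pair Minus) ms"
proof (induction ps)
  case Nil
  show ?case by (induction ms) (auto split: list.split)
qed simp

lemma boxes_of_reduced:
  assumes "reduced (signature l i D) = map (Pair Plus) ps @ map (Pair Minus) ms"
  shows "conormal_boxes l i D = ps" "normal_boxes l i D = ms"
  by (simp_all add: conormal_boxes_def normal_boxes_def assms filter_map comp_def)

lemma reduced_signature:
  "reduced (signature l i D) =
     map (Pair Plus) (conormal_boxes l i D) @ map (Pair Minus) (normal_boxes l i D)"
  using reduce_shape[of "signature l i D"] boxes_of_reduced by (metis reduced_eq_reduce)

lemma delete_pairs_reduced: "delete_pair\<^sup>*\<^sup>* w (reduced w)"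
  by (simp add: reduced_eq_reduce delete_pairs_reduce)

text \<open>Deletions preserve the order by content, and in the reduced word the conormal boxes
  precede the normal ones.\<close>

lemma sorted_boxes:
  assumes "is_partition D"
  shows "sorted_wrt (\<lambda>x y. content x < content y) (conormal_boxes l i D @ normal_boxes l i D)"
  using delete_pairs_sorted_wrt[OF delete_pairs_reduced sorted_signature[OF assms]]
  by (simp add: reduced_signature sorted_wrt_append sorted_wrt_map)

lemma
  assumes "is_partition D"
  shows conormal_box_move: "x \<in> set (conormal_boxes l i D) \<Longrightarrow> x \<in> moves l i D \<and> x \<notin> D"
    and normal_box_move: "x \<in> set (normal_boxes l i D) \<Longrightarrow> x \<in> moves l i D \<and> x \<in> D"
proof -
  have "set (reduced (signature l i D)) \<subseteq> (\<lambda>x. (if x \<in> D then Minus else Plus, x)) ` moves l i D"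
    using delete_pairs_set[OF delete_pairs_reduced] set_signature[OF assms] by blast
  then have "(Plus, x) \<in> (\<lambda>x. (if x \<in> D then Minus else Plus, x)) ` moves l i D"
    if "x \<in> set (conormal_boxes l i D)" for x
    using that by (auto simp: reduced_signature)
  then show "x \<in> set (conormal_boxes l i D) \<Longrightarrow> x \<in> moves l i D \<and> x \<notin> D"
    by (fastforce split: if_splits)
  have "(Minus, x) \<in> (\<lambda>x. (if x \<in> D then Minus else Plus, x)) ` moves l i D"
    if "x \<in> set (normal_boxes l i D)" for x
    using that \<open>set (reduced (signature l i D)) \<subseteq> _\<close> by (auto simp: reduced_signature)
  then show "x \<in> set (normal_boxes l i D) \<Longrightarrow> x \<in> moves l i D \<and> x \<in> D"
    by (fastforce split: if_splits)
qed

text \<open>The deletions that reduce the old signature also lead from the flipped signature to the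
  flipped reduced word. By its shape this word is already reduced.\<close>

lemma boxes_toggle:
  assumes l: "2 \<le> l" and D: "is_partition D"
    and x: "x \<in> set (conormal_boxes l i D @ normal_boxes l i D)"
    and shape: "map (flip x) (reduced (signature l i D)) = map (Pair Plus) ps @ map (Pair Minus) ms"
  shows "is_partition (toggle x D)" "conormal_boxes l i (toggle x D) = ps"
    "normal_boxes l i (toggle x D) = ms"
proof -
  have move: "x \<in> moves l i D" using x conormal_box_move[OF D, of x l i] normal_box_move[OF D, of x l i] by auto
  then show "is_partition (toggle x D)" by (simp add: moves_def)
  have "sorted_wrt (<) (map content (map snd (signature l i D)))"
    using sorted_signature[OF D] by (simp add: sorted_wrt_map)
  then have "distinct (map snd (signature l i D))" unfolding strict_sorted_iff distinct_map by blast
  moreover have "x \<in> snd ` set (reduced (signature l i D))"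
    using x by (force simp: reduced_signature)
  ultimately have "delete_pair\<^sup>*\<^sup>* (signature l i (toggle x D)) (map (Pair Plus) ps @ map (Pair Minus) ms)"
    using delete_pairs_flip[OF delete_pairs_reduced] by (metis shape signature_toggle[OF l D move])
  then have "reduced (signature l i (toggle x D)) = map (Pair Plus) ps @ map (Pair Minus) ms"
    by (simp add: reduced_eq_reduce reduce_delete_pairs reduce_of_shape)
  then show "conormal_boxes l i (toggle x D) = ps" "normal_boxes l i (toggle x D) = ms"
    by (rule boxes_of_reduced)+
qed

section \<open>Effect of the crystal operators on normal and conormal boxes\<close>

lemma map_flip_Pair: "z \<notin> set xs \<Longrightarrow> map (flip z) (map (Pair s) xs) = map (Pair s) xs"
  by (auto simp: flip_def)

lemma distinct_boxes:
  assumes "is_partition D"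
  shows "distinct (conormal_boxes l i D @ normal_boxes l i D)"
proof -
  have "sorted_wrt (<) (map content (conormal_boxes l i D @ normal_boxes l i D))"
    unfolding sorted_wrt_map by (rule sorted_boxes[OF assms])
  then show ?thesis unfolding strict_sorted_iff distinct_map by blast
qed

text \<open>The cogood box carries the last \<open>Plus\<close> of the reduced word, so its flip
  only shifts the border between the two blocks.\<close>

lemma f_op_boxes:
  assumes l: "2 \<le> l" and D: "is_partition D" and E: "f_op l i D = Some E"
  shows "is_partition E" "phi l i D = Suc (phi l i E)" "eps l i E = Suc (eps l i D)"
proof -
  define x ps where "x = last (conormal_boxes l i D)" and "ps = butlast (conormal_boxes l i D)"
  have ps: "conormal_boxes l i D = ps @ [x]" and Ex: "E = insert x D"
    using E by (auto simp: f_op_def x_def ps_def split: if_splits)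
  have "x \<notin> D" using conormal_box_move[OF D, of x l i] ps by simp
  then have toggle: "toggle x D = E" using Ex by (simp add: toggle_def)
  have "x \<notin> set ps" "x \<notin> set (normal_boxes l i D)" using distinct_boxes[OF D, of l i] ps by auto
  then have "map (flip x) (reduced (signature l i D)) =
      map (Pair Plus) ps @ map (Pair Minus) (x # normal_boxes l i D)"
    using map_flip_Pair[of x] by (simp add: reduced_signature ps) (simp add: flip_def)
  from boxes_toggle[OF l D _ this] ps toggle
  show "is_partition E" "phi l i D = Suc (phi l i E)" "eps l i E = Suc (eps l i D)"
    by (auto simp: phi_def eps_def)
qed

text \<open>Dually, the good box carries the first \<open>Minus\<close>, which becomes the last
  \<open>Plus\<close>.\<close>

lemma e_op_boxes:
  assumes l: "2 \<le> l" and D: "is_partition D" and E: "e_op l i D = Some E"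
  shows "is_partition E" "phi l i E = Suc (phi l i D)" "eps l i D = Suc (eps l i E)"
proof -
  define x ms where "x = hd (normal_boxes l i D)" and "ms = tl (normal_boxes l i D)"
  have ms: "normal_boxes l i D = x # ms" and Ex: "E = D - {x}"
    using E by (auto simp: e_op_def x_def ms_def split: if_splits)
  have "x \<in> D" using normal_box_move[OF D, of x l i] ms by simp
  then have toggle: "toggle x D = E" using Ex by (simp add: toggle_def)
  have "x \<notin> set (conormal_boxes l i D)" "x \<notin> set ms" using distinct_boxes[OF D, of l i] ms by auto
  then have "map (flip x) (reduced (signature l i D)) =
      map (Pair Plus) (conormal_boxes l i D @ [x]) @ map (Pair Minus) ms"
    using map_flip_Pair[of x] by (simp add: reduced_signature ms) (simp add: flip_def)
  from boxes_toggle[OF l D _ this] ms toggle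
  show "is_partition E" "phi l i E = Suc (phi l i D)" "eps l i D = Suc (eps l i E)"
    by (auto simp: phi_def eps_def)
qed

lemma iterate_Suc: "iterate g (Suc k) x = Option.bind (iterate g k x) g"
  by (simp add: iterate_def)

lemma iterate_f_op:
  assumes "2 \<le> l" "is_partition D" "iterate (f_op l i) k D = Some E"
  shows "is_partition E \<and> phi l i D = phi l i E + k \<and> eps l i E = eps l i D + k"
  using assms(3)
proof (induction k arbitrary: E)
  case 0
  then show ?case using assms(2) by (simp add: iterate_def)
next
  case (Suc k)
  then obtain E' where "iterate (f_op l i) k D = Some E'" "f_op l i E' = Some E"
    by (auto simp: iterate_Suc bind_eq_Some_conv)
  then show ?case using Suc.IH f_op_boxes[OF assms(1), of E' i E] by fastforce
qed

lemma iterate_e_op: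
  assumes "2 \<le> l" "is_partition D" "iterate (e_op l i) k D = Some E"
  shows "is_partition E \<and> phi l i E = phi l i D + k \<and> eps l i D = eps l i E + k"
  using assms(3)
proof (induction k arbitrary: E)
  case 0
  then show ?case using assms(2) by (simp add: iterate_def)
next
  case (Suc k)
  then obtain E' where "iterate (e_op l i) k D = Some E'" "e_op l i E' = Some E"
    by (auto simp: iterate_Suc bind_eq_Some_conv)
  then show ?case using Suc.IH e_op_boxes[OF assms(1), of E' i E] by fastforce
qed

subsection \<open>Normal boxes above conormal boxes\<close>

text \<open>The box \<open>y\<close> is the first free position of its row, which gives the bead. A
  bead one higher would belong to a row above, but those rows reach at least the column of
  \<open>y\<close>.\<close>

lemma addable_bead:
  assumes D: "is_partition D" and y: "y \<in> moves l i D" "y \<notin> D"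
  shows "content y \<in> range (bead D)" "content y + 1 \<notin> range (bead D)"
proof -
  obtain r j where rj: "y = (r, j)" by (cases y)
  have left: "(r, j') \<in> D" if "j = Suc j'" for j' using moves_left[OF D] y(1) that rj by simp
  have up: "(r', j) \<in> D" if "r = Suc r'" for r' using moves_above[OF D] y(1) that rj by simp
  have "part D r = j"
    using left y(2) rj by (cases j) (auto simp: mem_iff_less_part[OF D])
  then have bead: "bead D r = content y" by (simp add: rj bead_def content_def)
  then show "content y \<in> range (bead D)" by (metis rangeI)
  show "content y + 1 \<notin> range (bead D)"
  proof
    assume "content y + 1 \<in> range (bead D)"
    then obtain s where s: "bead D s = content y + 1" by fastforce
    then have "s < r" using bead bead_less_iff[OF D, of r s] by simp
    then obtain r' where r': "r = Suc r'" "s \<le> r'" by (cases r) auto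
    \<comment> \<open>One unit comes from the box above \<open>y\<close> being in \<open>D\<close>,
      the other from the row number being smaller by one.\<close>
    have "content y + 2 \<le> bead D r'"
      using up[OF r'(1)] r'(1) rj by (simp add: mem_iff_less_part[OF D] bead_def content_def)
    then show False using bead_antimono[OF D r'(2)] s by simp
  qed
qed

lemma removable_bead:
  assumes D: "is_partition D" and x: "x \<in> moves l i D" "x \<in> D"
  shows "content x + 1 \<in> range (bead D)"
proof -
  obtain r j where rj: "x = (r, j)" by (cases x)
  have "is_partition (D - {x})" using x by (simp add: moves_def toggle_def)
  then have "(r, Suc j) \<in> D - {x} \<longrightarrow> (r, j) \<in> D - {x}"
    unfolding is_partition_iff_local by blast
  then have "(r, Suc j) \<notin> D" by (simp add: rj)
  then have "part D r = Suc j" using x(2) rj by (simp add: mem_iff_less_part[OF D])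
  then have "bead D r = content x + 1" by (simp add: rj bead_def content_def)
  then show ?thesis by (metis rangeI)
qed

text \<open>In \<open>not_only_horizontal\<close>, \<open>b\<close> and \<open>m\<close> become the
  beads at \<open>content y2\<close> and \<open>content x + 1\<close>, and \<open>g\<close> the gap
  at \<open>content y1 + 1\<close>.\<close>

lemma not_l_partition:
  assumes l: "2 \<le> l" and "2 \<le> phi l i D" "1 \<le> eps l i D"
  shows "\<not> l_partition l D"
proof
  assume lp: "l_partition l D"
  then have D: "is_partition D" by (simp add: l_partition_def)
  obtain y1 y2 ps where ys: "conormal_boxes l i D = y1 # y2 # ps"
    using assms(2) unfolding phi_def by (metis Suc_le_length_iff numeral_2_eq_2)
  obtain x ms where x: "normal_boxes l i D = x # ms"
    using assms(3) unfolding eps_def by (metis Suc_le_length_iff One_nat_def)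
  have less: "content y1 < content y2" "content y2 < content x"
    using sorted_boxes[OF D, of l i] by (auto simp: ys x)
  have moves: "y1 \<in> moves l i D" "y1 \<notin> D" "y2 \<in> moves l i D" "y2 \<notin> D" "x \<in> moves l i D" "x \<in> D"
    using conormal_box_move[OF D, of _ l i] normal_box_move[OF D, of _ l i] by (auto simp: ys x)
  then have mod: "content y1 mod int l = content y2 mod int l" "content x mod int l = content y2 mod int l"
    by (auto simp: moves_def residue_def)
  then have "int l dvd content y2 - content y1" by (metis mod_eq_dvd_iff)
  then have "int l \<le> content y2 - content y1" using less by (intro zdvd_imp_le) auto
  \<comment> \<open>The strict inequality \<open>g < b\<close> comes from the distance of at least
    \<open>l\<close>, hence at least 2, between contents of equal residue.\<close>
  then have "content y1 + 1 < content y2" using l by linarith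
  moreover have "(content y1 + 1) mod int l = (content y2 + 1) mod int l"
    "(content x + 1) mod int l = (content y2 + 1) mod int l"
    using mod by (auto intro: mod_add_cong)
  moreover have "content y2 < content x + 1" using less by simp
  ultimately show False
    using not_only_horizontal[OF l l_partition_only_horizontal[OF lp], of "content y2" "content x + 1" "content y1 + 1"]
      addable_bead[OF D] removable_bead[OF D] moves by blast
qed

theorem theorem2p4p2p3:
  fixes l :: nat and i :: int and D :: diagram
  assumes "2 \<le> l"
    and "l_partition l D"
    and "0 \<le> i" and "i < int l"
  shows "(\<forall>k. 0 < k \<and> int k < int (phi l i D) - 1 \<longrightarrow>
            \<not> (\<exists>E. iterate (f_op l i) k D = Some E \<and> l_partition l E))
       \<and> (\<forall>k. 1 < k \<and> k < eps l i D \<longrightarrow>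
            \<not> (\<exists>E. iterate (e_op l i) k D = Some E \<and> l_partition l E))"
proof -
  have D: "is_partition D" using assms(2) by (simp add: l_partition_def)
  have "\<not> l_partition l E"
    if "0 < k" "int k < int (phi l i D) - 1" "iterate (f_op l i) k D = Some E" for k E
    using iterate_f_op[OF assms(1) D that(3)] that(1,2) by (intro not_l_partition[OF assms(1), of i]) auto
  \<comment> \<open>Here \<open>k\<close>, at least 2, conormal boxes are gained and at least one
    normal box remains.\<close>
  moreover have "\<not> l_partition l E"
    if "1 < k" "k < eps l i D" "iterate (e_op l i) k D = Some E" for k E
    using iterate_e_op[OF assms(1) D that(3)] that(1,2) by (intro not_l_partition[OF assms(1), of i]) auto
  ultimately show ?thesis by blast
qed

end
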